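(* Let $G$ be a connected graph with a set of cousins $C=\{\{v_1,v_2\},\{v_3,v_4\}\}$ satisfying: (i) $v_1,v_3$ are not adjacent and $v_2,v_4$ are not adjacent; (ii) the subgraph of $G+v_1v_3$ induced by $\{v_1,v_2,v_3,v_4\}$ is isomorphic to the subgraph of $G+v_2v_4$ induced by $\{v_1,v_2,v_3,v_4\}$ via the permutation $\sigma_1=(v_1v_4)(v_2v_3)$; (iii) for every $x\in N(v_1)\cap N(v_2)$ there exists $y\in N(v_3)\cap N(v_4)$ with $xy\in E(G)$, and for every $y\in N(v_3)\cap N(v_4)$ there exists $x\in N(v_1)\cap N(v_2)$ with $xy\in E(G)$. If $G_1=G+v_1v_3$ and $G_2=G+v_2v_4$ are not isomorphic, then they are $\mathcal D^L$-cospectral.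
   Context: All graphs are finite, simple, undirected; $N(v)$ is the set of neighbors of $v$; $G+xy$ denotes $G$ with edge $xy$ added. For a connected graph $G$ with vertices $w_1,\dots,w_n$, $d_G(u,v)$ is the length of a shortest $u,v$-path, $t_G(v)=\sum_w d_G(v,w)$, $\mathcal D(G)$ has $(i,j)$-entry $d_G(w_i,w_j)$, and $\mathcal D^L(G)=\operatorname{diag}(t_G(w_1),\dots,t_G(w_n))-\mathcal D(G)$. Nonisomorphic graphs are $\mathcal D^L$-cospectral if their distance Laplacian matrices have the same spectrum. Let $G$ be a connected graph of order at least five with distinct vertices $v_1,v_2,v_3,v_4$, $C=\{\{v_1,v_2\},\{v_3,v_4\}\}$ and $U(C)=V(G)\setminus\{v_1,v_2,v_3,v_4\}$; $C$ is a set of cousins in $G$ if (1) for all $u\in U(C)$, $d_G(u,v_1)=d_G(u,v_2)$ and $d_G(u,v_3)=d_G(u,v_4)$; and (2) $\sum_{u\in U(C)}d_G(u,v_1)=\sum_{u\in U(C)}d_G(u,v_3)$. *)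

theory Defs
  imports
    "Graph_Theory.Pair_Digraph"
    "Graph_Theory.Digraph_Isomorphism"
    "Jordan_Normal_Form.Char_Poly"
    "HOL-Combinatorics.Multiset_Permutations"
    "HOL-Combinatorics.Transposition"
begin

text \<open>
  A finite simple undirected graph is a \<open>pair_graph\<close>: a finite, loop-free, symmetric digraph
  whose arcs are pairs of vertices. An edge \<open>xy\<close> is represented by the two arcs \<open>(x, y)\<close> and
  \<open>(y, x)\<close>.
\<close>

definition add_edge :: "'a pair_pre_digraph \<Rightarrow> 'a \<Rightarrow> 'a \<Rightarrow> 'a pair_pre_digraph" where
  "add_edge G x y = \<lparr> pverts = pverts G, parcs = parcs G \<union> {(x, y), (y, x)} \<rparr>"

definition neighbors :: "'a pair_pre_digraph \<Rightarrow> 'a \<Rightarrow> 'a set" where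
  "neighbors G v = {w. (v, w) \<in> parcs G}"

text \<open>
  This is \<open>digraph_iso\<close> with the vertex map of the isomorphism prescribed.
\<close>
definition iso_via :: "('a \<Rightarrow> 'c) \<Rightarrow> ('a, 'b) pre_digraph \<Rightarrow> ('c, 'd) pre_digraph \<Rightarrow> bool" where
  "iso_via \<sigma> G H \<longleftrightarrow>
     (\<exists>f. iso_verts f = \<sigma> \<and> pre_digraph.digraph_isomorphism G f \<and> H = app_iso f G)"

text \<open>
  Only meaningful when some path from \<open>u\<close> to \<open>v\<close> exists, e.g. for vertices of a connected graph.
\<close>
definition graph_dist :: "'a pair_pre_digraph \<Rightarrow> 'a \<Rightarrow> 'a \<Rightarrow> nat" where
  "graph_dist G u v = (LEAST k. \<exists>p. pre_digraph.apath (with_proj G) u p v \<and> length p = k)"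

definition transmission :: "'a pair_pre_digraph \<Rightarrow> 'a \<Rightarrow> nat" where
  "transmission G v = (\<Sum>w\<in>pverts G. graph_dist G v w)"

text \<open>
  In the following definitions \<open>ws\<close> is the list of the vertices \<open>w\<^sub>1, \<dots>, w\<^sub>n\<close> of \<open>G\<close>, without
  repetition.
\<close>

definition distance_matrix :: "'a pair_pre_digraph \<Rightarrow> 'a list \<Rightarrow> real mat" where
  "distance_matrix G ws =
     mat (length ws) (length ws) (\<lambda>(i, j). real (graph_dist G (ws ! i) (ws ! j)))"

definition distance_laplacian :: "'a pair_pre_digraph \<Rightarrow> 'a list \<Rightarrow> real mat" where
  "distance_laplacian G ws =
     mat_diag (length ws) (\<lambda>i. real (transmission G (ws ! i))) - distance_matrix G ws"

text \<open>
  The spectrum is the multiset of eigenvalues, counted with multiplicity. The distance Laplacian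
  of a graph is a real symmetric matrix, so all of its eigenvalues are real.
\<close>
definition DL_spectrum :: "'a pair_pre_digraph \<Rightarrow> 'a list \<Rightarrow> real multiset" where
  "DL_spectrum G ws = proots (char_poly (distance_laplacian G ws))"

text \<open>
  The orderings of the vertices are arbitrary, hence the quantification over all of them.
\<close>
definition DL_cospectral :: "'a pair_pre_digraph \<Rightarrow> 'b pair_pre_digraph \<Rightarrow> bool" where
  "DL_cospectral G H \<longleftrightarrow>
     \<not> digraph_iso (with_proj G) (with_proj H) \<and>
     (\<forall>ws \<in> permutations_of_set (pverts G). \<forall>vs \<in> permutations_of_set (pverts H).
        DL_spectrum G ws = DL_spectrum H vs)"

text \<open>
  \<open>cousins G v1 v2 v3 v4\<close> means that \<open>C = {{v1, v2}, {v3, v4}}\<close> is a set of cousins in the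
  connected graph \<open>G\<close>; \<open>U\<close> below is \<open>U(C)\<close>.
\<close>
definition cousins :: "'a pair_pre_digraph \<Rightarrow> 'a \<Rightarrow> 'a \<Rightarrow> 'a \<Rightarrow> 'a \<Rightarrow> bool" where
  "cousins G v1 v2 v3 v4 \<longleftrightarrow>
     5 \<le> card (pverts G) \<and>
     {v1, v2, v3, v4} \<subseteq> pverts G \<and> distinct [v1, v2, v3, v4] \<and>
     (let U = pverts G - {v1, v2, v3, v4} in
        (\<forall>u\<in>U. graph_dist G u v1 = graph_dist G u v2 \<and> graph_dist G u v3 = graph_dist G u v4) \<and>
        (\<Sum>u\<in>U. graph_dist G u v1) = (\<Sum>u\<in>U. graph_dist G u v3))"

end

theory Submission
  imports Defs
begin

text \<open>
  Adding an edge \<open>ab\<close> changes distances by an explicit minimum formula. Condition (iii) forces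
  \<open>\<bar>d(u, v\<^sub>1) - d(u, v\<^sub>3)\<bar> \<le> 1\<close> for \<open>u\<close> outside the cousins, so neither new edge
  changes a distance between such a \<open>u\<close> and a cousin, and the two new graphs agree on the
  remaining distances except that the values at \<open>v\<^sub>1v\<^sub>3\<close> and \<open>v\<^sub>2v\<^sub>4\<close> are interchanged; here one
  needs \<open>d(v\<^sub>1, v\<^sub>2) = d(v\<^sub>3, v\<^sub>4) \<le> 2\<close> and \<open>d(v\<^sub>1, v\<^sub>3) = d(v\<^sub>2, v\<^sub>4) \<le> 3\<close>. The two distance
  Laplacians are then conjugate under the reflection \<open>I - w w\<^sup>T / 2\<close>, where \<open>w\<close> takes the values
  \<open>1, -1, -1, 1\<close> at \<open>v\<^sub>1, v\<^sub>2, v\<^sub>3, v\<^sub>4\<close> and vanishes elsewhere.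
\<close>

section \<open>Distances in connected graphs\<close>

text \<open>\<open>graph_dist\<close> minimises over paths, while concatenation only yields walks.
  Reducing a walk to a path only cuts out cycles, so walks give upper bounds as well.\<close>

lemma (in wf_digraph) length_awalk_to_apath:
  assumes "awalk u p v"
  shows "length (awalk_to_apath p) \<le> length p"
  using assms
proof (induct rule: awalk_to_apath_induct)
  case (path p)
  then have "awalk_to_apath p = p"
    by (auto simp: awalk_to_apath.simps)
  then show ?case by simp
next
  case (decomp p q r s)
  then have "length (q @ s) \<le> length p"
    by (auto elim!: awalk_cyc_decompE)
  with decomp show ?case using step_awalk_to_apath[of _ p _ q r s] by simp
qed

section \<open>Walks and distances via powers of the arc relation\<close>

context pair_wf_digraph
begin

lemma awalk_imp_relpow: "awalk u p v \<Longrightarrow> (u, v) \<in> parcs G ^^ length p"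
proof (induction p arbitrary: u)
  case Nil
  then show ?case by (auto simp: awalk_Nil_iff)
next
  case (Cons e p)
  then have "e \<in> parcs G" "fst e = u" "(snd e, v) \<in> parcs G ^^ length p"
    by (auto simp: awalk_Cons_iff)
  then show ?case
    by (metis length_Cons prod.collapse relpow_Suc_I2)
qed

text \<open>The hypothesis on \<open>u\<close> covers \<open>k = 0\<close>: the zeroth power relates
  every element of the type to itself, but the empty walk must sit at a vertex.\<close>

lemma relpow_imp_awalk:
  "(u, v) \<in> parcs G ^^ k \<Longrightarrow> u \<in> pverts G \<Longrightarrow> \<exists>p. awalk u p v \<and> length p = k"
proof (induction k arbitrary: u)
  case 0
  then show ?case by (auto simp: awalk_Nil_iff)
next
  case (Suc k)
  then obtain w where w: "(u, w) \<in> parcs G" "(w, v) \<in> parcs G ^^ k"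
    by (metis relpow_Suc_D2)
  then obtain p where "awalk w p v" "length p = k"
    using Suc.IH wellformed'(2) by blast
  with w show ?case
    by (intro exI[of _ "(u, w) # p"]) (auto simp: awalk_Cons_iff)
qed

lemma graph_dist_le:
  assumes "(u, v) \<in> parcs G ^^ k" "u \<in> pverts G"
  shows "graph_dist G u v \<le> k"
proof -
  obtain p where p: "awalk u p v" "length p = k"
    using relpow_imp_awalk assms by blast
  have "graph_dist G u v \<le> length (awalk_to_apath p)"
    unfolding graph_dist_def by (rule Least_le) (use apath_awalk_to_apath p in blast)
  with length_awalk_to_apath p show ?thesis by fastforce
qed

lemma relpow_graph_dist:
  assumes "(u, v) \<in> parcs G ^^ k" "u \<in> pverts G"
  shows "(u, v) \<in> parcs G ^^ graph_dist G u v"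
proof -
  obtain p where "awalk u p v"
    using relpow_imp_awalk assms by blast
  then have "\<exists>q. apath u q v \<and> length q = length (awalk_to_apath p)"
    using apath_awalk_to_apath by blast
  then have "\<exists>q. apath u q v \<and> length q = graph_dist G u v"
    unfolding graph_dist_def by (rule LeastI)
  then show ?thesis
    by (metis awalkI_apath awalk_imp_relpow)
qed

end

locale connected_graph = pair_graph G for G :: "'a pair_pre_digraph" +
  assumes connected: "Digraph_Component.connected (with_proj G)"
begin

abbreviation d :: "'a \<Rightarrow> 'a \<Rightarrow> nat" where "d \<equiv> graph_dist G"

lemma relpow_d:
  assumes "u \<in> pverts G" "v \<in> pverts G"
  shows "(u, v) \<in> parcs G ^^ d u v"
proof -
  \<comment> \<open>\<open>connected\<close> speaks of the symmetric closure of the graph; since the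
    arcs are already symmetric, reachability there is reachability in \<open>G\<close>.\<close>
  have "u \<rightarrow>\<^sup>*\<^bsub>with_proj G\<^esub> v"
    using connected assms reachable_mk_symmetric_eq[OF pair_sym_arcs]
    unfolding connected_def strongly_connected_def by (simp add: mk_symmetric_def)
  then obtain p where "awalk u p v"
    by (auto simp: reachable_awalk)
  then show ?thesis
    using awalk_imp_relpow relpow_graph_dist assms by blast
qed

lemma d_triangle:
  assumes "u \<in> pverts G" "v \<in> pverts G" "w \<in> pverts G"
  shows "d u w \<le> d u v + d v w"
proof -
  have "(u, w) \<in> parcs G ^^ (d u v + d v w)"
    using relpow_d assms by (auto simp: relpow_add)
  then show ?thesis using graph_dist_le assms by blast
qed

lemma relpow_sym: "(u, v) \<in> parcs G ^^ k \<Longrightarrow> (v, u) \<in> parcs G ^^ k"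
proof (induction k arbitrary: u v)
  case (Suc k)
  then obtain w where "(u, w) \<in> parcs G ^^ k" "(w, v) \<in> parcs G" by auto
  with Suc.IH show ?case by (meson arcs_symmetric relpow_Suc_I2)
qed auto

lemma d_sym:
  assumes "u \<in> pverts G" "v \<in> pverts G"
  shows "d u v = d v u"
  using graph_dist_le[OF relpow_sym[OF relpow_d]] assms by (intro antisym) auto

lemma d_self: "u \<in> pverts G \<Longrightarrow> d u u = 0"
  using graph_dist_le[of u u 0] by simp

lemma d_eq_0_iff: "u \<in> pverts G \<Longrightarrow> v \<in> pverts G \<Longrightarrow> d u v = 0 \<longleftrightarrow> u = v"
  using relpow_d[of u v] d_self by auto

lemma d_eq_1_iff:
  assumes "u \<in> pverts G" "v \<in> pverts G"
  shows "d u v = 1 \<longleftrightarrow> (u, v) \<in> parcs G"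
proof
  assume "d u v = 1"
  then show "(u, v) \<in> parcs G" using relpow_d[OF assms] by simp
next
  assume e: "(u, v) \<in> parcs G"
  then have "d u v \<le> 1" using graph_dist_le[of u v 1] assms by simp
  moreover have "d u v \<noteq> 0" using d_eq_0_iff assms e no_loops' by blast
  ultimately show "d u v = 1" by simp
qed

lemma d_le_1: "(u, v) \<in> parcs G \<Longrightarrow> d u v \<le> 1"
  using graph_dist_le[of u v 1] wellformed' by simp

text \<open>Drop the last arc of a shortest walk; by the triangle inequality what remains is again
  shortest.\<close>

lemma d_last_step:
  assumes "u \<in> pverts G" "v \<in> pverts G" "u \<noteq> v"
  obtains w where "w \<in> pverts G" "(w, v) \<in> parcs G" "d u v = d u w + 1"
proof -
  obtain k where k: "d u v = Suc k"
    using assms d_eq_0_iff not0_implies_Suc by blast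
  then obtain w where w: "(u, w) \<in> parcs G ^^ k" "(w, v) \<in> parcs G"
    using relpow_d[OF assms(1,2)] by auto
  then have wV: "w \<in> pverts G" using wellformed' by blast
  have "d u w \<le> k" using graph_dist_le w assms by blast
  moreover have "d u v \<le> d u w + d w v" using d_triangle assms wV by blast
  moreover have "d w v \<le> 1" using w d_le_1 by blast
  ultimately show thesis using that wV w k by simp
qed

text \<open>A shortest path crosses the new edge at most once, in one of two directions. Instead of
  counting crossings, the proof shows that the right-hand side grows by at most 1 along every arc of
  the enlarged graph.\<close>

lemma graph_dist_add_edge:
  assumes "a \<in> pverts G" "b \<in> pverts G" "u \<in> pverts G" "v \<in> pverts G"
  shows "graph_dist (add_edge G a b) u v = min (d u v) (min (d u a + 1 + d b v) (d u b + 1 + d a v))"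
    (is "_ = ?m v")
proof -
  let ?E = "parcs (add_edge G a b)"
  interpret H: pair_wf_digraph "add_edge G a b"
    using assms by unfold_locales (auto simp: add_edge_def dest: wellformed')
  have verts: "pverts (add_edge G a b) = pverts G" and arcs: "?E = parcs G \<union> {(a, b), (b, a)}"
    by (auto simp: add_edge_def)
  have walk: "(x, y) \<in> ?E ^^ d x y" if "x \<in> pverts G" "y \<in> pverts G" for x y
  proof -
    have "parcs G ^^ k \<subseteq> ?E ^^ k" for k
      by (induction k) (auto simp: arcs)
    then show ?thesis using relpow_d[OF that] by blast
  qed
  have new: "(x, y) \<in> ?E ^^ (d x a' + 1 + d b' y)"
    if "(a', b') \<in> ?E" "x \<in> pverts G" "y \<in> pverts G" "a' \<in> pverts G" "b' \<in> pverts G" for x y a' b'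
  proof -
    have "(x, b') \<in> ?E ^^ (d x a' + 1)"
      using walk[of x a'] that by auto
    then show ?thesis using walk[of b' y] that relpow_add by blast
  qed
  have upper: "graph_dist (add_edge G a b) u v \<le> ?m v"
    using H.graph_dist_le[OF walk[of u v]] H.graph_dist_le[OF new[of a b u v]]
      H.graph_dist_le[OF new[of b a u v]] assms verts arcs by simp
  have lower: "?m y \<le> k" if "(u, y) \<in> ?E ^^ k" "y \<in> pverts G" for y k
    using that
  proof (induction k arbitrary: y)
    case 0
    then show ?case using d_self by simp
  next
    case (Suc k)
    then obtain z where z: "(u, z) \<in> ?E ^^ k" "(z, y) \<in> ?E" by auto
    then have zV: "z \<in> pverts G" using H.wellformed' verts by blast
    have IH: "?m z \<le> k" using Suc.IH z zV by blast
    consider "(z, y) \<in> parcs G" | "z = a" "y = b" | "z = b" "y = a"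
      using z arcs by auto
    then show ?case
    proof cases
      case 1
      then have "d x y \<le> d x z + 1" if "x \<in> pverts G" for x
        using d_triangle[of x z y] d_le_1[of z y] that zV Suc.prems by simp
      from this[of u] this[of a] this[of b] IH assms show ?thesis by auto
    \<comment> \<open>Crossing from \<open>a\<close> to \<open>b\<close>: either
      \<open>d u a \<le> k\<close>, and the detour through \<open>a\<close> ends at \<open>b\<close>
      after \<open>k + 1\<close> steps, or the minimum at \<open>a\<close> was already reached
      through \<open>b\<close>, and then \<open>d u b < k\<close>.\<close>
    qed (use IH assms d_self in auto)
  qed
  show ?thesis
    using upper lower[OF H.relpow_graph_dist[OF walk]] assms verts by (intro antisym) auto
qed

text \<open>Take the predecessor \<open>y\<close> of \<open>b\<close> on a shortest path from
  \<open>u\<close>. Outside the four vertices it is adjacent to \<open>b'\<close> too, so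
  \<open>linked\<close> supplies a neighbor \<open>x\<close> of \<open>a\<close> adjacent to
  \<open>y\<close>, and replacing the final step to \<open>b\<close> by the two steps through
  \<open>x\<close> to \<open>a\<close> costs one more.\<close>

lemma d_twin_le:
  assumes V: "{a, a', b, b'} \<subseteq> pverts G"
    and twins_a: "\<And>w. w \<in> pverts G - {a, a', b, b'} \<Longrightarrow> d w a = d w a'"
    and twins_b: "\<And>w. w \<in> pverts G - {a, a', b, b'} \<Longrightarrow> d w b = d w b'"
    and nonadj: "(a, b) \<notin> parcs G"
    and linked: "\<And>y. y \<in> neighbors G b \<inter> neighbors G b' \<Longrightarrow>
      \<exists>x \<in> neighbors G a \<inter> neighbors G a'. (x, y) \<in> parcs G"
    and u: "u \<in> pverts G - {a, a', b, b'}"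
  shows "d u a \<le> d u b + 1"
proof -
  obtain y where y: "y \<in> pverts G" "(y, b) \<in> parcs G" "d u b = d u y + 1"
    using d_last_step[of u b] u V by auto
  show ?thesis
  proof (cases "y \<in> {a, a', b, b'}")
    case True
    \<comment> \<open>Only \<open>a'\<close> survives: \<open>a\<close> is not adjacent to
      \<open>b\<close>, there are no loops, and \<open>b'\<close> is as far from \<open>u\<close> as
      \<open>b\<close>.\<close>
    moreover have "y \<noteq> a" using y nonadj by blast
    moreover have "y \<noteq> b" using y(2) no_loops' by blast
    moreover have "y \<noteq> b'" using y twins_b[OF u] by auto
    ultimately have "y = a'" by blast
    then show ?thesis using y twins_a[OF u] by simp
  next
    case False
    then have "(y, b') \<in> parcs G"
      using twins_b[of y] y V d_eq_1_iff[of y b] d_eq_1_iff[of y b'] by auto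
    then obtain x where x: "(a, x) \<in> parcs G" "(x, y) \<in> parcs G"
      using linked[of y] y arcs_symmetric by (auto simp: neighbors_def)
    then have "x \<in> pverts G" using wellformed' by blast
    then have "d u a \<le> d u y + d y x + d x a"
      using d_triangle[of u x a] d_triangle[of u y x] u y V by fastforce
    moreover have "d y x \<le> 1" "d x a \<le> 1"
      using x arcs_symmetric d_le_1 by blast+
    ultimately show ?thesis using y by simp
  qed
qed

end

section \<open>Distances after adding an edge between cousins\<close>

text \<open>Condition (ii) enters as \<open>adj12_iff_adj34\<close>, a form that is invariant under
  exchanging \<open>v1\<close> with \<open>v2\<close> and \<open>v3\<close> with
  \<open>v4\<close>.\<close>

locale linked_cousins = connected_graph G
  for G :: "'a pair_pre_digraph" and v1 v2 v3 v4 :: 'a +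
  assumes cousins: "cousins G v1 v2 v3 v4"
    and nonadj13: "(v1, v3) \<notin> parcs G" and nonadj24: "(v2, v4) \<notin> parcs G"
    and adj12_iff_adj34: "(v1, v2) \<in> parcs G \<longleftrightarrow> (v3, v4) \<in> parcs G"
    and linked1: "\<forall>x \<in> neighbors G v1 \<inter> neighbors G v2.
      \<exists>y \<in> neighbors G v3 \<inter> neighbors G v4. (x, y) \<in> parcs G"
    and linked2: "\<forall>y \<in> neighbors G v3 \<inter> neighbors G v4.
      \<exists>x \<in> neighbors G v1 \<inter> neighbors G v2. (x, y) \<in> parcs G"
begin

abbreviation U :: "'a set" where "U \<equiv> pverts G - {v1, v2, v3, v4}"

lemma verts: "v1 \<in> pverts G" "v2 \<in> pverts G" "v3 \<in> pverts G" "v4 \<in> pverts G"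
  and neqs: "v1 \<noteq> v2" "v1 \<noteq> v3" "v1 \<noteq> v4" "v2 \<noteq> v3" "v2 \<noteq> v4" "v3 \<noteq> v4"
  using cousins unfolding cousins_def by auto

lemma twins: "u \<in> U \<Longrightarrow> d u v1 = d u v2" "u \<in> U \<Longrightarrow> d u v3 = d u v4"
  using cousins unfolding cousins_def Let_def by auto

text \<open>This symmetry turns each fact about the graph with edge \<open>v1 v3\<close> into one
  about the graph with edge \<open>v2 v4\<close>.\<close>

lemma linked_cousins_swap: "linked_cousins G v2 v1 v4 v3"
proof unfold_locales
  have "{v2, v1, v4, v3} = {v1, v2, v3, v4}" by auto
  moreover have "(\<Sum>u\<in>U. d u v1) = (\<Sum>u\<in>U. d u v2)" "(\<Sum>u\<in>U. d u v3) = (\<Sum>u\<in>U. d u v4)"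
    using twins by (auto intro: sum.cong)
  ultimately show "cousins G v2 v1 v4 v3"
    using cousins unfolding cousins_def Let_def by auto
  show "(v2, v1) \<in> parcs G \<longleftrightarrow> (v4, v3) \<in> parcs G"
    using adj12_iff_adj34 arcs_symmetric by blast
qed (use nonadj13 nonadj24 linked1 linked2 in auto)

lemma common_neighbors: "x \<in> neighbors G v1 \<inter> neighbors G v2 \<Longrightarrow> x \<in> U"
  "y \<in> neighbors G v3 \<inter> neighbors G v4 \<Longrightarrow> y \<in> U"
  using nonadj13 nonadj24 wellformed' no_loops' arcs_symmetric
  unfolding neighbors_def by blast+

lemma adj_twins:
  assumes "u \<in> U"
  shows "(u, v1) \<in> parcs G \<longleftrightarrow> (u, v2) \<in> parcs G" "(u, v3) \<in> parcs G \<longleftrightarrow> (u, v4) \<in> parcs G"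
  using twins[OF assms] assms verts
    d_eq_1_iff[of u v1] d_eq_1_iff[of u v2] d_eq_1_iff[of u v3] d_eq_1_iff[of u v4] by auto

text \<open>These bounds make the new edge useless between \<open>u\<close> and a cousin: reaching
  \<open>v1\<close> through \<open>v3\<close> costs \<open>d u v3 + 1\<close>, and
  symmetrically.\<close>

lemma d_U_bounds:
  assumes "u \<in> U"
  shows "d u v1 \<le> d u v3 + 1" "d u v3 \<le> d u v1 + 1"
proof -
  show "d u v1 \<le> d u v3 + 1"
    by (rule d_twin_le[of v1 v2 v3 v4]) (use assms verts twins nonadj13 linked2 in auto)
  have "\<exists>y \<in> neighbors G v3 \<inter> neighbors G v4. (y, x) \<in> parcs G"
    if "x \<in> neighbors G v1 \<inter> neighbors G v2" for x
    using linked1 that arcs_symmetric by blast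
  then show "d u v3 \<le> d u v1 + 1"
    by (intro d_twin_le[of v3 v4 v1 v2]) (use assms verts twins nonadj13 arcs_symmetric in auto)
qed

text \<open>Order at least five makes \<open>U\<close> nonempty. The predecessor of a vertex of
  \<open>U\<close> nearest to \<open>v1\<close> must be a cousin, so that vertex is a common
  neighbor of a cousin pair, and condition (iii) provides its partner.\<close>

lemma linked_neighbors_exist:
  obtains x y where "x \<in> neighbors G v1 \<inter> neighbors G v2" "y \<in> neighbors G v3 \<inter> neighbors G v4"
    "(x, y) \<in> parcs G"
proof -
  have "card {v1, v2, v3, v4} \<le> 4"
    by (simp add: card_insert_if)
  then have "U \<noteq> {}"
    using cousins card_mono[of "{v1, v2, v3, v4}" "pverts G"] unfolding cousins_def by auto
  then obtain u where u: "u \<in> U" and min: "\<And>w. w \<in> U \<Longrightarrow> d v1 u \<le> d v1 w"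
    using ex_has_least_nat[of "\<lambda>w. w \<in> U" _ "d v1"] by blast
  obtain w where w: "w \<in> pverts G" "(w, u) \<in> parcs G" "d v1 u = d v1 w + 1"
    using d_last_step[of v1 u] u verts by auto
  then have "w \<in> {v1, v2, v3, v4}"
    using min[of w] by auto
  moreover have "(u, w) \<in> parcs G" using w arcs_symmetric by blast
  ultimately have "u \<in> neighbors G v1 \<inter> neighbors G v2 \<or> u \<in> neighbors G v3 \<inter> neighbors G v4"
    using adj_twins[OF u] arcs_symmetric unfolding neighbors_def by blast
  then show thesis using that linked1 linked2 by blast
qed

lemma d12_le_2: "d v1 v2 \<le> 2" and d34_le_2: "d v3 v4 \<le> 2" and d13_le_3: "d v1 v3 \<le> 3"
proof -
  obtain x y where "x \<in> neighbors G v1 \<inter> neighbors G v2" "y \<in> neighbors G v3 \<inter> neighbors G v4"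
    and xy: "(x, y) \<in> parcs G"
    by (rule linked_neighbors_exist)
  then have "(v1, x) \<in> parcs G" "(x, v2) \<in> parcs G" "(v3, y) \<in> parcs G" "(y, v3) \<in> parcs G"
    "(y, v4) \<in> parcs G"
    using arcs_symmetric unfolding neighbors_def by auto
  then have "d v1 x \<le> 1" "d x v2 \<le> 1" "d v3 y \<le> 1" "d y v3 \<le> 1" "d y v4 \<le> 1" "d x y \<le> 1"
    "x \<in> pverts G" "y \<in> pverts G"
    using xy d_le_1 wellformed' by blast+
  with d_triangle[of v1 x v2] d_triangle[of v3 y v4] d_triangle[of v1 x v3] d_triangle[of x y v3] verts
  show "d v1 v2 \<le> 2" "d v3 v4 \<le> 2" "d v1 v3 \<le> 3" by auto
qed

lemma d12_eq_d34: "d v1 v2 = d v3 v4"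
  using d12_le_2 d34_le_2 adj12_iff_adj34 d_eq_0_iff[of v1 v2] d_eq_0_iff[of v3 v4]
    d_eq_1_iff[of v1 v2] d_eq_1_iff[of v3 v4] verts neqs by linarith

lemma d13_ge_2: "2 \<le> d v1 v3"
  using d_eq_0_iff[of v1 v3] d_eq_1_iff[of v1 v3] nonadj13 verts neqs by linarith

lemma d24_le_2:
  assumes "d v1 v3 \<le> 2"
  shows "d v2 v4 \<le> 2"
proof -
  obtain z where z: "z \<in> pverts G" "(z, v3) \<in> parcs G" "d v1 v3 = d v1 z + 1"
    using d_last_step[of v1 v3] verts neqs by auto
  then have "d v1 z = 1"
    using assms d13_ge_2 by simp
  then have v1z: "(v1, z) \<in> parcs G"
    using d_eq_1_iff verts z by blast
  have "\<exists>z \<in> pverts G. (v2, z) \<in> parcs G \<and> (z, v4) \<in> parcs G"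
  proof (cases "z \<in> {v1, v2, v3, v4}")
    case True
    then consider "z = v2" | "z = v4"
      using v1z z no_loops' by blast
    then show ?thesis
      \<comment> \<open>The witness is \<open>v3\<close> if \<open>z = v2\<close>, and
        \<open>v1\<close> if \<open>z = v4\<close>; both need the edges \<open>v1 v2\<close> and
        \<open>v3 v4\<close> to occur together.\<close>
      using v1z z arcs_symmetric adj12_iff_adj34 verts by cases blast+
  next
    case False
    then show ?thesis
      using v1z z arcs_symmetric adj_twins[of z] by blast
  qed
  then obtain z' where "z' \<in> pverts G" "d v2 z' \<le> 1" "d z' v4 \<le> 1"
    using d_le_1 by blast
  then show ?thesis
    using d_triangle[of v2 z' v4] verts by simp
qed

text \<open>Both values are 2 or 3, and by \<open>d24_le_2\<close> and its swapped version one is 2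
  exactly when the other is.\<close>

lemma d13_eq_d24: "d v1 v3 = d v2 v4"
proof -
  interpret swap: linked_cousins G v2 v1 v4 v3 by (rule linked_cousins_swap)
  show ?thesis
    using d24_le_2 swap.d24_le_2 d13_ge_2 swap.d13_ge_2 d13_le_3 swap.d13_le_3 by linarith
qed

section \<open>Distances to and among the cousins in the graph with edge
  \<open>v1 v3\<close>\<close>

abbreviation "G13 \<equiv> add_edge G v1 v3"
abbreviation "G24 \<equiv> add_edge G v2 v4"

lemma graph_dist_G13_U:
  assumes "u \<in> U"
  shows "graph_dist G13 u v1 = d u v1" "graph_dist G13 u v2 = d u v1"
    "graph_dist G13 u v3 = d u v3" "graph_dist G13 u v4 = d u v3"
    "graph_dist G13 v1 u = d u v1" "graph_dist G13 v2 u = d u v1"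
    "graph_dist G13 v3 u = d u v3" "graph_dist G13 v4 u = d u v3"
  using assms d_U_bounds[OF assms] twins[OF assms] verts d_sym[of _ u]
  by (auto simp: graph_dist_add_edge)

text \<open>A detour between \<open>v1\<close> and \<open>v2\<close>, or between \<open>v3\<close>
  and \<open>v4\<close>, has length at least 2, and one between \<open>v2\<close> and
  \<open>v4\<close> at least 3, so these distances stay. Those of \<open>v1 v4\<close> and
  \<open>v2 v3\<close> may drop, but to values that the edge \<open>v2 v4\<close> produces as
  well.\<close>

lemma graph_dist_G13_V:
  shows "graph_dist G13 v1 v2 = d v1 v2" "graph_dist G13 v2 v1 = d v1 v2"
    "graph_dist G13 v3 v4 = d v1 v2" "graph_dist G13 v4 v3 = d v1 v2"
    "graph_dist G13 v1 v3 = 1" "graph_dist G13 v3 v1 = 1"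
    "graph_dist G13 v2 v4 = d v1 v3" "graph_dist G13 v4 v2 = d v1 v3"
    "graph_dist G13 v1 v4 = min (d v1 v4) (1 + d v1 v2)" "graph_dist G13 v4 v1 = min (d v1 v4) (1 + d v1 v2)"
    "graph_dist G13 v2 v3 = min (d v2 v3) (1 + d v1 v2)" "graph_dist G13 v3 v2 = min (d v2 v3) (1 + d v1 v2)"
proof -
  have pos: "d x y \<ge> 1" if "x \<in> pverts G" "y \<in> pverts G" "x \<noteq> y" for x y
    using d_eq_0_iff[of x y] that by linarith
  have "d v1 v2 \<ge> 1" "d v1 v4 \<ge> 1" "d v2 v3 \<ge> 1"
    using pos verts neqs by blast+
  then show "graph_dist G13 v1 v2 = d v1 v2" "graph_dist G13 v2 v1 = d v1 v2"
    "graph_dist G13 v3 v4 = d v1 v2" "graph_dist G13 v4 v3 = d v1 v2"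
    "graph_dist G13 v1 v3 = 1" "graph_dist G13 v3 v1 = 1"
    "graph_dist G13 v2 v4 = d v1 v3" "graph_dist G13 v4 v2 = d v1 v3"
    "graph_dist G13 v1 v4 = min (d v1 v4) (1 + d v1 v2)" "graph_dist G13 v4 v1 = min (d v1 v4) (1 + d v1 v2)"
    "graph_dist G13 v2 v3 = min (d v2 v3) (1 + d v1 v2)" "graph_dist G13 v3 v2 = min (d v2 v3) (1 + d v1 v2)"
    using d12_le_2 d13_ge_2 d13_le_3 d12_eq_d34 d13_eq_d24 verts d_self
      d_sym[of v2 v1] d_sym[of v4 v3] d_sym[of v3 v1] d_sym[of v4 v2] d_sym[of v4 v1] d_sym[of v3 v2]
    by (simp_all add: graph_dist_add_edge)
qed

end

section \<open>Matrices indexed by vertices\<close>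

text \<open>Separate orderings for rows and columns let one matrix both change the basis and reorder
  the vertices.\<close>

definition indexed_mat :: "'a list \<Rightarrow> 'a list \<Rightarrow> ('a \<Rightarrow> 'a \<Rightarrow> 'b) \<Rightarrow> 'b mat" where
  "indexed_mat ws vs A = mat (length ws) (length vs) (\<lambda>(i, j). A (ws ! i) (vs ! j))"

lemma indexed_mat_carrier: "indexed_mat ws vs A \<in> carrier_mat (length ws) (length vs)"
  by (simp add: indexed_mat_def)

lemma indexed_mat_cong:
  assumes "\<And>x y. x \<in> set ws \<Longrightarrow> y \<in> set vs \<Longrightarrow> A x y = B x y"
  shows "indexed_mat ws vs A = indexed_mat ws vs B"
  using assms by (auto simp: indexed_mat_def)

lemma indexed_mat_mult:
  fixes A B :: "'a \<Rightarrow> 'a \<Rightarrow> 'b :: comm_ring_1"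
  assumes "distinct zs"
  shows "indexed_mat ws zs A * indexed_mat zs vs B
    = indexed_mat ws vs (\<lambda>x y. \<Sum>z\<in>set zs. A x z * B z y)"
proof -
  have "(\<Sum>k = 0..<length zs. f (zs ! k)) = (\<Sum>z\<in>set zs. f z)" for f :: "'a \<Rightarrow> 'b"
    using sum.reindex_bij_betw[OF bij_betw_nth[OF assms refl refl]]
    by (simp add: atLeast0LessThan)
  then show ?thesis
    by (auto simp: indexed_mat_def scalar_prod_def intro!: eq_matI)
qed

lemma indexed_mat_one:
  assumes "distinct ws"
  shows "indexed_mat ws ws (\<lambda>x y. if x = y then 1 else 0) = 1\<^sub>m (length ws)"
  using assms by (auto simp: indexed_mat_def nth_eq_iff_index_eq)

text \<open>The hypotheses say \<open>Q Q = I\<close> and \<open>A Q = Q B\<close>. Reading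
  \<open>Q\<close> with rows \<open>ws\<close> and columns \<open>vs\<close>, and the other way
  round, gives mutually inverse matrices, hence a similarity across the two orderings.\<close>

lemma char_poly_indexed_mat_involution:
  fixes Q A B :: "'a \<Rightarrow> 'a \<Rightarrow> 'b :: comm_ring_1"
  assumes ws: "distinct ws" "set ws = V" and vs: "distinct vs" "set vs = V"
    and QQ: "\<And>x y. x \<in> V \<Longrightarrow> y \<in> V \<Longrightarrow> (\<Sum>z\<in>V. Q x z * Q z y) = (if x = y then 1 else 0)"
    and QA: "\<And>x y. x \<in> V \<Longrightarrow> y \<in> V \<Longrightarrow> (\<Sum>z\<in>V. A x z * Q z y) = (\<Sum>z\<in>V. Q x z * B z y)"
  shows "char_poly (indexed_mat ws ws A) = char_poly (indexed_mat vs vs B)"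
proof -
  let ?n = "length ws"
  have len: "length vs = ?n"
    using ws vs distinct_card by metis
  let ?P = "indexed_mat ws vs Q" and ?P' = "indexed_mat vs ws Q"
  have carrier: "?P \<in> carrier_mat ?n ?n" "?P' \<in> carrier_mat ?n ?n"
    "indexed_mat ws ws A \<in> carrier_mat ?n ?n" "indexed_mat vs vs B \<in> carrier_mat ?n ?n"
    using indexed_mat_carrier len by metis+
  have "?P * ?P' = indexed_mat ws ws (\<lambda>x y. if x = y then 1 else 0)"
    unfolding indexed_mat_mult[OF vs(1)] by (rule indexed_mat_cong) (use QQ ws vs in auto)
  then have one: "?P * ?P' = 1\<^sub>m ?n"
    by (simp add: indexed_mat_one ws)
  have "?P' * ?P = indexed_mat vs vs (\<lambda>x y. if x = y then 1 else 0)"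
    unfolding indexed_mat_mult[OF ws(1)] by (rule indexed_mat_cong) (use QQ ws vs in auto)
  then have one': "?P' * ?P = 1\<^sub>m ?n"
    by (simp add: indexed_mat_one vs len)
  have AP: "indexed_mat ws ws A * ?P = ?P * indexed_mat vs vs B"
    unfolding indexed_mat_mult[OF ws(1)] indexed_mat_mult[OF vs(1)]
    by (rule indexed_mat_cong) (use QA ws vs in auto)
  have "indexed_mat ws ws A = indexed_mat ws ws A * (?P * ?P')"
    using one carrier by simp
  also have "\<dots> = ?P * indexed_mat vs vs B * ?P'"
    using assoc_mult_mat[OF carrier(3,1,2)] AP by simp
  finally have "similar_mat (indexed_mat ws ws A) (indexed_mat vs vs B)"
    by (intro similar_matI[of _ _ ?P ?P' ?n] one one') (use carrier in auto)
  then show ?thesis by (rule char_poly_similar)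
qed

text \<open>
  This is the reflection along \<open>w\<close> only if \<open>w\<close> has squared norm 4.
\<close>

definition householder :: "('a \<Rightarrow> real) \<Rightarrow> 'a \<Rightarrow> 'a \<Rightarrow> real" where
  "householder w x y = (if x = y then 1 else 0) - w x * w y / 2"

lemma
  assumes "finite V" "x \<in> V"
  shows sum_householder_left: "(\<Sum>z\<in>V. householder w x z * A z) = A x - w x * (\<Sum>z\<in>V. w z * A z) / 2"
    and sum_householder_right: "(\<Sum>z\<in>V. A z * householder w z x) = A x - (\<Sum>z\<in>V. w z * A z) * w x / 2"
proof -
  have left: "householder w x z * A z = (if z = x then A z else 0) - w x / 2 * (w z * A z)"
    and right: "A z * householder w z x = (if z = x then A z else 0) - w x / 2 * (w z * A z)" for z
    by (simp_all add: householder_def algebra_simps)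
  have "(\<Sum>z\<in>V. if z = x then A z else 0) = A x"
    using assms by simp
  moreover have "(\<Sum>z\<in>V. w x / 2 * (w z * A z)) = w x / 2 * (\<Sum>z\<in>V. w z * A z)"
    by (rule sum_distrib_left[symmetric])
  ultimately have "(\<Sum>z\<in>V. (if z = x then A z else 0) - w x / 2 * (w z * A z))
    = A x - w x / 2 * (\<Sum>z\<in>V. w z * A z)"
    by (simp only: sum_subtractf)
  then show "(\<Sum>z\<in>V. householder w x z * A z) = A x - w x * (\<Sum>z\<in>V. w z * A z) / 2"
    "(\<Sum>z\<in>V. A z * householder w z x) = A x - (\<Sum>z\<in>V. w z * A z) * w x / 2"
    unfolding left right by simp_all
qed

lemma char_poly_indexed_mat_householder:
  fixes A B :: "'a \<Rightarrow> 'a \<Rightarrow> real"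
  assumes V: "finite V"
    and ws: "distinct ws" "set ws = V" and vs: "distinct vs" "set vs = V"
    and norm: "(\<Sum>z\<in>V. w z * w z) = 4"
    and conj: "\<And>x y. x \<in> V \<Longrightarrow> y \<in> V \<Longrightarrow>
      A x y - (\<Sum>z\<in>V. w z * A x z) * w y / 2 = B x y - w x * (\<Sum>z\<in>V. w z * B z y) / 2"
  shows "char_poly (indexed_mat ws ws A) = char_poly (indexed_mat vs vs B)"
proof (rule char_poly_indexed_mat_involution[OF ws vs, where Q = "householder w"])
  fix x y assume xy: "x \<in> V" "y \<in> V"
  \<comment> \<open>With squared norm 4 this is \<open>- w y\<close>: the reflection negates
    \<open>w\<close>, which makes it an involution.\<close>
  have "(\<Sum>z\<in>V. w z * householder w z y) = w y - (\<Sum>z\<in>V. w z * w z) * w y / 2"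
    using sum_householder_right[OF V xy(2)] .
  then show "(\<Sum>z\<in>V. householder w x z * householder w z y) = (if x = y then 1 else 0)"
    by (simp add: sum_householder_left[OF V xy(1)] norm) (simp add: householder_def)
  show "(\<Sum>z\<in>V. A x z * householder w z y) = (\<Sum>z\<in>V. householder w x z * B z y)"
    using conj[OF xy] by (simp add: sum_householder_left[OF V xy(1)] sum_householder_right[OF V xy(2)])
qed

definition laplacian_entry :: "'a pair_pre_digraph \<Rightarrow> 'a \<Rightarrow> 'a \<Rightarrow> real" where
  "laplacian_entry G x y = (if x = y then real (transmission G x) else 0) - real (graph_dist G x y)"

lemma distance_laplacian_eq_indexed_mat:
  assumes "distinct ws"
  shows "distance_laplacian G ws = indexed_mat ws ws (laplacian_entry G)"
proof -
  have "ws ! i = ws ! j \<longleftrightarrow> i = j" if "i < length ws" "j < length ws" for i j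
    using assms that by (simp add: nth_eq_iff_index_eq)
  then show ?thesis
    unfolding distance_laplacian_def distance_matrix_def mat_diag_def indexed_mat_def laplacian_entry_def
    by (intro eq_matI) simp_all
qed

section \<open>Conjugation of the distance Laplacians\<close>

context linked_cousins
begin

lemma graph_dist_G24_U:
  assumes "u \<in> U"
  shows "graph_dist G24 u v1 = d u v1" "graph_dist G24 u v2 = d u v1"
    "graph_dist G24 u v3 = d u v3" "graph_dist G24 u v4 = d u v3"
    "graph_dist G24 v1 u = d u v1" "graph_dist G24 v2 u = d u v1"
    "graph_dist G24 v3 u = d u v3" "graph_dist G24 v4 u = d u v3"
proof -
  interpret swap: linked_cousins G v2 v1 v4 v3 by (rule linked_cousins_swap)
  have "u \<in> swap.U" using assms by auto
  from swap.graph_dist_G13_U[OF this] twins[OF assms]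
  show "graph_dist G24 u v1 = d u v1" "graph_dist G24 u v2 = d u v1"
    "graph_dist G24 u v3 = d u v3" "graph_dist G24 u v4 = d u v3"
    "graph_dist G24 v1 u = d u v1" "graph_dist G24 v2 u = d u v1"
    "graph_dist G24 v3 u = d u v3" "graph_dist G24 v4 u = d u v3"
    by simp_all
qed

lemma graph_dist_G24_V:
  shows "graph_dist G24 v1 v2 = d v1 v2" "graph_dist G24 v2 v1 = d v1 v2"
    "graph_dist G24 v3 v4 = d v1 v2" "graph_dist G24 v4 v3 = d v1 v2"
    "graph_dist G24 v2 v4 = 1" "graph_dist G24 v4 v2 = 1"
    "graph_dist G24 v1 v3 = d v1 v3" "graph_dist G24 v3 v1 = d v1 v3"
    "graph_dist G24 v1 v4 = min (d v1 v4) (1 + d v1 v2)" "graph_dist G24 v4 v1 = min (d v1 v4) (1 + d v1 v2)"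
    "graph_dist G24 v2 v3 = min (d v2 v3) (1 + d v1 v2)" "graph_dist G24 v3 v2 = min (d v2 v3) (1 + d v1 v2)"
proof -
  interpret swap: linked_cousins G v2 v1 v4 v3 by (rule linked_cousins_swap)
  have "d v2 v1 = d v1 v2" "d v2 v4 = d v1 v3"
    using d_sym verts d13_eq_d24 by auto
  with swap.graph_dist_G13_V
  show "graph_dist G24 v1 v2 = d v1 v2" "graph_dist G24 v2 v1 = d v1 v2"
    "graph_dist G24 v3 v4 = d v1 v2" "graph_dist G24 v4 v3 = d v1 v2"
    "graph_dist G24 v2 v4 = 1" "graph_dist G24 v4 v2 = 1"
    "graph_dist G24 v1 v3 = d v1 v3" "graph_dist G24 v3 v1 = d v1 v3"
    "graph_dist G24 v1 v4 = min (d v1 v4) (1 + d v1 v2)" "graph_dist G24 v4 v1 = min (d v1 v4) (1 + d v1 v2)"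
    "graph_dist G24 v2 v3 = min (d v2 v3) (1 + d v1 v2)" "graph_dist G24 v3 v2 = min (d v2 v3) (1 + d v1 v2)"
    by simp_all
qed

text \<open>Each of \<open>u\<close> and \<open>w\<close> is equidistant from the members of a pair,
  so the detours over \<open>v1 v3\<close> and over \<open>v2 v4\<close> have the same
  lengths.\<close>

lemma graph_dist_U_U:
  assumes "u \<in> U" "w \<in> U"
  shows "graph_dist G13 u w = graph_dist G24 u w"
  using assms verts twins[OF assms(1)] twins[OF assms(2)] d_sym[of _ w]
  by (simp add: graph_dist_add_edge)

lemma graph_dist_refl:
  assumes "x \<in> pverts G"
  shows "graph_dist G13 x x = 0" "graph_dist G24 x x = 0"
  using assms verts d_self by (auto simp: graph_dist_add_edge)

lemma sum_verts:
  fixes f :: "'a \<Rightarrow> 'b :: comm_monoid_add"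
  shows "(\<Sum>x\<in>pverts G. f x) = (\<Sum>x\<in>U. f x) + (f v1 + (f v2 + (f v3 + f v4)))"
proof -
  have "(\<Sum>x\<in>pverts G. f x) = (\<Sum>x\<in>U. f x) + (\<Sum>x\<in>{v1, v2, v3, v4}. f x)"
    using verts pair_finite_verts by (intro sum.subset_diff) auto
  then show ?thesis using neqs by simp
qed

section \<open>Transmissions in the two new graphs\<close>

definition "S = (\<Sum>u\<in>U. d u v1)"
definition "d14 = min (d v1 v4) (1 + d v1 v2)"
definition "d23 = min (d v2 v3) (1 + d v1 v2)"

lemmas dist_V = graph_dist_G13_V[folded d14_def d23_def] graph_dist_G24_V[folded d14_def d23_def]

text \<open>Clause (2) of the definition of cousins equates the sums for \<open>v1\<close> and
  \<open>v3\<close>; the twin property extends this to \<open>v2\<close> and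
  \<open>v4\<close>.\<close>

lemma sum_graph_dist_U:
  "(\<Sum>u\<in>U. graph_dist G13 v1 u) = S" "(\<Sum>u\<in>U. graph_dist G13 v2 u) = S"
  "(\<Sum>u\<in>U. graph_dist G13 v3 u) = S" "(\<Sum>u\<in>U. graph_dist G13 v4 u) = S"
  "(\<Sum>u\<in>U. graph_dist G24 v1 u) = S" "(\<Sum>u\<in>U. graph_dist G24 v2 u) = S"
  "(\<Sum>u\<in>U. graph_dist G24 v3 u) = S" "(\<Sum>u\<in>U. graph_dist G24 v4 u) = S"
proof -
  have "S = (\<Sum>u\<in>U. d u v3)"
    using cousins unfolding S_def cousins_def Let_def by blast
  then have sum_v1: "(\<And>u. u \<in> U \<Longrightarrow> f u = d u v1) \<Longrightarrow> sum f U = S"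
    and sum_v3: "(\<And>u. u \<in> U \<Longrightarrow> f u = d u v3) \<Longrightarrow> sum f U = S" for f
    using sum.cong[OF refl, of U f] by (metis S_def)+
  show "(\<Sum>u\<in>U. graph_dist G13 v1 u) = S" "(\<Sum>u\<in>U. graph_dist G13 v2 u) = S"
    "(\<Sum>u\<in>U. graph_dist G24 v1 u) = S" "(\<Sum>u\<in>U. graph_dist G24 v2 u) = S"
    by (rule sum_v1, simp add: graph_dist_G13_U graph_dist_G24_U)+
  show "(\<Sum>u\<in>U. graph_dist G13 v3 u) = S" "(\<Sum>u\<in>U. graph_dist G13 v4 u) = S"
    "(\<Sum>u\<in>U. graph_dist G24 v3 u) = S" "(\<Sum>u\<in>U. graph_dist G24 v4 u) = S"
    by (rule sum_v3, simp add: graph_dist_G13_U graph_dist_G24_U)+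
qed

lemma transmission_U:
  assumes "u \<in> U"
  shows "transmission G13 u = transmission G24 u"
proof -
  have "pverts G13 = pverts G" "pverts G24 = pverts G" by (simp_all add: add_edge_def)
  moreover have "(\<Sum>w\<in>U. graph_dist G13 u w) = (\<Sum>w\<in>U. graph_dist G24 u w)"
    using graph_dist_U_U assms by (intro sum.cong) auto
  ultimately show ?thesis
    using assms by (simp add: transmission_def sum_verts graph_dist_G13_U graph_dist_G24_U)
qed

text \<open>Passing from \<open>G13\<close> to \<open>G24\<close> exchanges the summands
  \<open>1\<close> and \<open>b\<close> at every cousin.\<close>

lemma transmission_V:
  defines "a \<equiv> d v1 v2" and "b \<equiv> d v1 v3"
  shows "transmission G13 v1 = S + a + 1 + d14" "transmission G13 v2 = S + a + d23 + b"
    "transmission G13 v3 = S + 1 + d23 + a" "transmission G13 v4 = S + d14 + b + a"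
    "transmission G24 v1 = S + a + b + d14" "transmission G24 v2 = S + a + d23 + 1"
    "transmission G24 v3 = S + b + d23 + a" "transmission G24 v4 = S + d14 + 1 + a"
proof -
  have "pverts G13 = pverts G" "pverts G24 = pverts G" by (simp_all add: add_edge_def)
  then show "transmission G13 v1 = S + a + 1 + d14" "transmission G13 v2 = S + a + d23 + b"
    "transmission G13 v3 = S + 1 + d23 + a" "transmission G13 v4 = S + d14 + b + a"
    "transmission G24 v1 = S + a + b + d14" "transmission G24 v2 = S + a + d23 + 1"
    "transmission G24 v3 = S + b + d23 + a" "transmission G24 v4 = S + d14 + 1 + a"
    unfolding a_def b_def
    by (simp_all only: transmission_def sum_verts sum_graph_dist_U dist_V
        graph_dist_refl verts)
qed

text \<open>With unit vectors \<open>e1, ..., e4\<close> at the cousins this is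
  \<open>(e1 - e3) - (e2 - e4)\<close>, so its reflection exchanges \<open>e1 - e3\<close> and
  \<open>e2 - e4\<close>, and thereby the Laplacian contributions of the pairs \<open>v1 v3\<close>
  and \<open>v2 v4\<close>. It is an eigenvector of the remaining part, which both graphs
  share.\<close>

definition cousin_sign :: "'a \<Rightarrow> real" where
  "cousin_sign x = (if x = v1 \<or> x = v4 then 1 else if x = v2 \<or> x = v3 then -1 else 0)"

lemma cousin_sign_simps:
  "cousin_sign v1 = 1" "cousin_sign v2 = -1" "cousin_sign v3 = -1" "cousin_sign v4 = 1"
  "x \<in> U \<Longrightarrow> cousin_sign x = 0"
  using neqs by (auto simp: cousin_sign_def)

lemma sum_cousin_sign: "(\<Sum>x\<in>pverts G. cousin_sign x * f x) = f v1 - f v2 - f v3 + f v4"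
  by (simp add: sum_verts cousin_sign_simps)

abbreviation "L13 \<equiv> laplacian_entry G13"
abbreviation "L24 \<equiv> laplacian_entry G24"

lemma laplacian_U_U: "x \<in> U \<Longrightarrow> y \<in> U \<Longrightarrow> L13 x y = L24 x y"
  by (simp add: laplacian_entry_def graph_dist_U_U transmission_U)

lemma laplacian_U:
  assumes "u \<in> U"
  shows "L13 u v1 = - d u v1" "L13 u v2 = - d u v1" "L13 u v3 = - d u v3" "L13 u v4 = - d u v3"
    "L24 u v1 = - d u v1" "L24 u v2 = - d u v1" "L24 u v3 = - d u v3" "L24 u v4 = - d u v3"
    "L13 v1 u = - d u v1" "L13 v2 u = - d u v1" "L13 v3 u = - d u v3" "L13 v4 u = - d u v3"
    "L24 v1 u = - d u v1" "L24 v2 u = - d u v1" "L24 v3 u = - d u v3" "L24 v4 u = - d u v3"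
  using assms unfolding laplacian_entry_def graph_dist_G13_U[OF assms] graph_dist_G24_U[OF assms]
  by auto

lemma laplacian_V:
  fixes a b c e :: real
  defines "a \<equiv> real (d v1 v2)" and "b \<equiv> real (d v1 v3)" and "c \<equiv> real d14" and "e \<equiv> real d23"
  shows "L13 v1 v1 = S + a + 1 + c" "L13 v2 v2 = S + a + e + b"
    "L13 v3 v3 = S + 1 + e + a" "L13 v4 v4 = S + c + b + a"
    "L24 v1 v1 = S + a + b + c" "L24 v2 v2 = S + a + e + 1"
    "L24 v3 v3 = S + b + e + a" "L24 v4 v4 = S + c + 1 + a"
    "L13 v1 v2 = - a" "L13 v2 v1 = - a" "L13 v3 v4 = - a" "L13 v4 v3 = - a"
    "L24 v1 v2 = - a" "L24 v2 v1 = - a" "L24 v3 v4 = - a" "L24 v4 v3 = - a"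
    "L13 v1 v3 = - 1" "L13 v3 v1 = - 1" "L13 v2 v4 = - b" "L13 v4 v2 = - b"
    "L24 v1 v3 = - b" "L24 v3 v1 = - b" "L24 v2 v4 = - 1" "L24 v4 v2 = - 1"
    "L13 v1 v4 = - c" "L13 v4 v1 = - c" "L13 v2 v3 = - e" "L13 v3 v2 = - e"
    "L24 v1 v4 = - c" "L24 v4 v1 = - c" "L24 v2 v3 = - e" "L24 v3 v2 = - e"
  unfolding laplacian_entry_def a_def b_def c_def e_def
  using neqs neqs[symmetric] by (simp_all add: transmission_V dist_V graph_dist_refl verts)

text \<open>This is \<open>L13 Q = Q L24\<close> entrywise, \<open>Q\<close> being the reflection
  along \<open>cousin_sign\<close>. Rows and columns at \<open>U\<close> are orthogonal to
  \<open>cousin_sign\<close> because twin entries cancel, so only the block of the four cousins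
  needs a computation.\<close>

lemma laplacian_conj:
  assumes "x \<in> pverts G" "y \<in> pverts G"
  shows "L13 x y - (\<Sum>z\<in>pverts G. cousin_sign z * L13 x z) * cousin_sign y / 2
    = L24 x y - cousin_sign x * (\<Sum>z\<in>pverts G. cousin_sign z * L24 z y) / 2"
proof -
  consider "x \<in> U" | "x \<in> {v1, v2, v3, v4}" using assms by blast
  moreover consider "y \<in> U" | "y \<in> {v1, v2, v3, v4}" using assms by blast
  ultimately consider "x \<in> U" "y \<in> U" | "x \<in> U" "y \<in> {v1, v2, v3, v4}"
    | "x \<in> {v1, v2, v3, v4}" "y \<in> U" | "x \<in> {v1, v2, v3, v4}" "y \<in> {v1, v2, v3, v4}"
    by metis
  then show ?thesis
  proof cases
    case 1
    then show ?thesis by (simp only: cousin_sign_simps laplacian_U_U)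
  next
    case 2
    then show ?thesis
      by (elim insertE emptyE) (simp_all only: sum_cousin_sign cousin_sign_simps laplacian_U, simp_all)
  next
    case 3
    then show ?thesis
      by (elim insertE emptyE) (simp_all only: sum_cousin_sign cousin_sign_simps laplacian_U, simp_all)
  next
    case 4
    then show ?thesis
      by (elim insertE emptyE)
        (simp_all only: sum_cousin_sign cousin_sign_simps laplacian_V, simp_all add: field_simps)
  qed
qed

lemma DL_spectrum_eq:
  assumes "ws \<in> permutations_of_set (pverts G)" "vs \<in> permutations_of_set (pverts G)"
  shows "DL_spectrum G13 ws = DL_spectrum G24 vs"
proof -
  have ws: "distinct ws" "set ws = pverts G" and vs: "distinct vs" "set vs = pverts G"
    using assms by (auto dest: permutations_of_setD)
  have "char_poly (indexed_mat ws ws (laplacian_entry G13))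
    = char_poly (indexed_mat vs vs (laplacian_entry G24))"
    using laplacian_conj
    by (intro char_poly_indexed_mat_householder[OF pair_finite_verts ws vs, where w = cousin_sign])
      (simp_all add: sum_cousin_sign cousin_sign_simps)
  then show ?thesis
    by (simp add: DL_spectrum_def distance_laplacian_eq_indexed_mat ws vs)
qed

end

section \<open>Extracting adjacency from condition (ii), and the theorem\<close>

lemma iso_via_arcs:
  assumes "iso_via \<sigma> (with_proj G \<restriction> W) (with_proj H \<restriction> W')"
    and "(x, y) \<in> parcs G" "x \<in> W" "y \<in> W"
  shows "(\<sigma> x, \<sigma> y) \<in> parcs H"
proof -
  obtain f where f: "iso_verts f = \<sigma>" "pre_digraph.digraph_isomorphism (with_proj G \<restriction> W) f"
    and H: "with_proj H \<restriction> W' = app_iso f (with_proj G \<restriction> W)"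
    using assms(1) unfolding iso_via_def by blast
  have e: "(x, y) \<in> arcs (with_proj G \<restriction> W)"
    using assms by simp
  \<comment> \<open>\<open>app_iso\<close> installs \<open>iso_tail f\<close> and
    \<open>iso_head f\<close> as the incidence maps, so equality with a pair digraph forces the
    projections. The arc map is then \<open>\<sigma>\<close> on both components.\<close>
  have ends: "iso_tail f = fst" "iso_head f = snd"
    using arg_cong[OF H, of tail] arg_cong[OF H, of head] by simp_all
  have "iso_arcs f (x, y) \<in> arcs (with_proj H \<restriction> W')"
    using e unfolding H by auto
  moreover have "iso_arcs f (x, y) = (\<sigma> x, \<sigma> y)"
    using pre_digraph.iso_verts_tail[OF f(2) e] pre_digraph.iso_verts_head[OF f(2) e] ends f(1)
    by (simp add: prod_eq_iff)
  ultimately show ?thesis by simp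
qed

theorem theorem3p11:
  fixes G :: "'a pair_pre_digraph" and v1 v2 v3 v4 :: 'a
  assumes "pair_graph G"
    and "Digraph_Component.connected (with_proj G)"
    and "cousins G v1 v2 v3 v4"
    and "(v1, v3) \<notin> parcs G" and "(v2, v4) \<notin> parcs G"
    and "iso_via (transpose v1 v4 \<circ> transpose v2 v3)
           (with_proj (add_edge G v1 v3) \<restriction> {v1, v2, v3, v4})
           (with_proj (add_edge G v2 v4) \<restriction> {v1, v2, v3, v4})"
    and "\<forall>x \<in> neighbors G v1 \<inter> neighbors G v2. \<exists>y \<in> neighbors G v3 \<inter> neighbors G v4. (x, y) \<in> parcs G"
    and "\<forall>y \<in> neighbors G v3 \<inter> neighbors G v4. \<exists>x \<in> neighbors G v1 \<inter> neighbors G v2. (x, y) \<in> parcs G"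
    and "\<not> digraph_iso (with_proj (add_edge G v1 v3)) (with_proj (add_edge G v2 v4))"
  shows "DL_cospectral (add_edge G v1 v3) (add_edge G v2 v4)"
proof -
  interpret connected_graph G
    using assms by (simp add: connected_graph_def connected_graph_axioms_def)
  have neqs: "distinct [v1, v2, v3, v4]"
    using assms(3) by (simp add: cousins_def)
  let ?\<sigma> = "transpose v1 v4 \<circ> transpose v2 v3"
  have \<sigma>: "?\<sigma> v1 = v4" "?\<sigma> v2 = v3" "?\<sigma> v3 = v2" "?\<sigma> v4 = v1"
    using neqs by (auto simp: transpose_def)
  have arcs: "(?\<sigma> x, ?\<sigma> y) \<in> parcs (add_edge G v2 v4)"
    if "(x, y) \<in> parcs G" "x \<in> {v1, v2, v3, v4}" "y \<in> {v1, v2, v3, v4}" for x y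
    by (rule iso_via_arcs[OF assms(6)]) (use that in \<open>auto simp: add_edge_def\<close>)
  \<comment> \<open>The permutation sends \<open>v1 v2\<close> to \<open>v4 v3\<close> and
    \<open>v3 v4\<close> to \<open>v2 v1\<close>; neither image is the added edge
    \<open>v2 v4\<close>, so both lie in \<open>G\<close> itself.\<close>
  have "(v1, v2) \<in> parcs G \<longleftrightarrow> (v3, v4) \<in> parcs G"
    using arcs[of v1 v2] arcs[of v3 v4] arcs_symmetric neqs unfolding \<sigma>
    by (auto simp: add_edge_def)
  then interpret linked_cousins G v1 v2 v3 v4
    using assms by unfold_locales
  show ?thesis
    using assms(9) DL_spectrum_eq unfolding DL_cospectral_def by (simp add: add_edge_def)
qed

end
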